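(* Let $J\ge 3$ and let $F\in\tilde{\mathfrak{F}}$ be a symmetric cdf. The model $(\text{sequential},F,\text{complete})$ is invariant under the transposition $\tilde{\tau}$ of the last two categories (the permutation of $\{1,\dots,J\}$ exchanging $J-1$ and $J$).
   Context: Setting. Let $J\ge 3$ (number of categories), $p\ge 1$, and let $\mathcal{X}\subseteq\mathbb{R}^p$ be the nonempty set of values of the explanatory vector $x$. Let $\mathcal{M}=\{\pi\in\,]0,1[^{J-1} : \sum_{j=1}^{J-1}\pi_j<1\}$; for $\pi\in\mathcal{M}$ put $\pi_J=1-\sum_{j=1}^{J-1}\pi_j$ ($\pi_j$ is the probability of category $j$). Ratio. The sequential ratio $r:\mathcal{M}\to\,]0,1[^{J-1}$ is $r_j(\pi)=\pi_j/(\pi_j+\dots+\pi_J)$, $j=1,\dots,J-1$; it is a bijection onto $]0,1[^{J-1}$. Cdfs. $\tilde{\mathfrak{F}}$ is the set of continuous cumulative distribution functions $F$ on $\mathbb{R}$ that are strictly increasing on the open interval $I_F=\{w: 0<F(w)<1\}$ (so that $F$ maps $I_F$ bijectively onto $]0,1[$) and symmetric, i.e. $F(w)=1-F(-w)$ for all $w$. Design matrix. "Complete" refers to the $(J-1)\times(J-1)(1+p)$ matrix $Z_c(x)$ with $Z_c(x)\beta=(\alpha_j+x^t\delta_j)_{j=1,\dots,J-1}$ for $\beta=(\alpha_1,\dots,\alpha_{J-1},\delta_1^t,\dots,\delta_{J-1}^t)^t$, $\alpha_j\in\mathbb{R}$, $\delta_j\in\mathbb{R}^p$. Models. A model $(r,F,Z)$,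 with $Z$ having $q$ columns, has as parameter space the set of $\beta\in\mathbb{R}^q$ such that for all $x\in\mathcal{X}$, $\eta=Z(x)\beta$ satisfies $\eta\in I_F^{J-1}$ and $(F(\eta_1),\dots,F(\eta_{J-1}))\in r(\mathcal{M})$. For such $\beta$ and $x\in\mathcal{X}$, it defines the unique $\pi=\pi(x;\beta)\in\mathcal{M}$ with $r(\pi)=(F(\eta_1),\dots,F(\eta_{J-1}))^t$, $\eta=Z(x)\beta$. Permuted models. For a permutation $\sigma$ of $\{1,\dots,J\}$ and $\pi\in\mathcal{M}$, let $\pi_\sigma=(\pi_{\sigma(1)},\dots,\pi_{\sigma(J-1)})\in\mathcal{M}$. The permuted model $(r,F,Z)_\sigma$ has the same parameter space as $(r,F,Z)$ and defines $\pi=\pi(x;\beta)\in\mathcal{M}$ by $r(\pi_\sigma)=(F(\eta_1),\dots,F(\eta_{J-1}))^t$, $\eta=Z(x)\beta$. Equivalence and invariance. Two (possibly permuted) models, giving $\pi(x;\beta)$ and $\pi'(x;\beta')$, are equivalent if there is a bijection $h$ from the parameter space of the first to that of the second such that $\pi(x;\beta)=\pi'(x;h(\beta))$ for all $x\in\mathcal{X}$ and all $\beta$ in the first parameter space. A model $(r,F,Z)$ is invariant under $\sigma$ if $(r,F,Z)$ and $(r,F,Z)_\sigma$ are equivalent. *)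

theory Defs
  imports
    "HOL-Probability.Distribution_Functions"
    "HOL-Combinatorics.Transposition"
    "Jordan_Normal_Form.Matrix"
begin

unbundle no vec_syntax

text \<open>
  Categories and coordinates are numbered from 0: category \<open>j\<close> of the usual numbering
  \<open>1, \<dots>, J\<close> is index \<open>j - 1\<close> here, so the last two categories are \<open>J - 2\<close> and \<open>J - 1\<close>.
  The space of real \<open>n\<close>-vectors is \<^term>\<open>carrier_vec n :: real vec set\<close>.
\<close>

definition prob_simplex :: "nat \<Rightarrow> real vec set" where
  "prob_simplex J =
    {\<pi> \<in> carrier_vec (J - 1). (\<forall>j<J - 1. 0 < \<pi> $ j \<and> \<pi> $ j < 1) \<and> (\<Sum>j<J - 1. \<pi> $ j) < 1}"

definition cat_prob :: "nat \<Rightarrow> real vec \<Rightarrow> nat \<Rightarrow> real" where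
  "cat_prob J \<pi> j = (if j < J - 1 then \<pi> $ j else 1 - (\<Sum>i<J - 1. \<pi> $ i))"

definition sequential :: "nat \<Rightarrow> real vec \<Rightarrow> real vec" where
  "sequential J \<pi> =
    Matrix.vec (J - 1) (\<lambda>j. cat_prob J \<pi> j / (\<Sum>k = j..<J. cat_prob J \<pi> k))"

definition cdf_interval :: "(real \<Rightarrow> real) \<Rightarrow> real set" where
  "cdf_interval F = {w. 0 < F w \<and> F w < 1}"

definition symmetric_cdfs :: "(real \<Rightarrow> real) set" where
  "symmetric_cdfs =
    {F. (\<exists>M. real_distribution M \<and> F = cdf M) \<and> continuous_on UNIV F \<and>
        strict_mono_on (cdf_interval F) F \<and> (\<forall>w. F w = 1 - F (- w))}"

text \<open>
  The columns follow \<open>\<beta> = (\<alpha>\<^sub>0, \<dots>, \<alpha>\<^sub>J\<^sub>-\<^sub>2, \<delta>\<^sub>0, \<dots>, \<delta>\<^sub>J\<^sub>-\<^sub>2)\<close>, each \<open>\<delta>\<^sub>j\<close> being a block of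
  length \<open>p\<close>; see \<open>complete_design_mult_vec\<close> below.
\<close>

definition complete_ncols :: "nat \<Rightarrow> nat \<Rightarrow> nat" where
  "complete_ncols J p = (J - 1) * (1 + p)"

definition complete_design :: "nat \<Rightarrow> nat \<Rightarrow> real vec \<Rightarrow> real mat" where
  "complete_design J p x =
    Matrix.mat (J - 1) (complete_ncols J p) (\<lambda>(j, k).
      if k < J - 1 then (if k = j then 1 else 0)
      else if (k - (J - 1)) div p = j then x $ ((k - (J - 1)) mod p) else 0)"

lemma complete_design_mult_vec:
  assumes "\<beta> \<in> carrier_vec (complete_ncols J p)" and "j < J - 1"
  shows "(complete_design J p x *\<^sub>v \<beta>) $ j =
    \<beta> $ j + (\<Sum>l<p. x $ l * \<beta> $ (J - 1 + j * p + l))"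
proof -
  define n where "n = J - 1"
  define f where "f = (\<lambda>k. (if k < n then (if k = j then 1 else 0)
      else if (k - n) div p = j then x $ ((k - n) mod p) else 0) * \<beta> $ k)"
  have j: "j < n" using assms by (simp add: n_def)
  have q: "complete_ncols J p = n + n * p"
    unfolding complete_ncols_def n_def by (simp only: distrib_left mult_1_right)
  then have "dim_vec \<beta> = n + n * p" using assms by simp
  then have "(complete_design J p x *\<^sub>v \<beta>) $ j = sum f {..<n + n * p}"
    unfolding complete_design_def q n_def[symmetric] using j
    by (simp add: scalar_prod_def f_def lessThan_atLeast0)
  also have "\<dots> = sum f {0..<n} + sum f {n..<n + n * p}"
    by (simp add: lessThan_atLeast0 sum.atLeastLessThan_concat)
  also have "sum f {n..<n + n * p} = (\<Sum>i<n * p. f (n + i))"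
    using sum.shift_bounds_nat_ivl[of f 0 n "n * p"] by (simp add: lessThan_atLeast0 add_ac)
  also have "sum f {0..<n} = sum f {..<n}" by (simp add: lessThan_atLeast0)
  also have "sum f {..<n} = \<beta> $ j"
  proof -
    have "sum f {..<n} = (\<Sum>k<n. if k = j then \<beta> $ k else 0)"
      by (rule sum.cong) (auto simp: f_def)
    then show ?thesis using j by simp
  qed
  also have "(\<Sum>i<n * p. f (n + i)) = (\<Sum>i<n. \<Sum>k = i * p..<i * p + p. f (n + k))"
    using sum.nat_group[of "\<lambda>i. f (n + i)" p n] by simp
  also have "\<dots> = (\<Sum>i<n. \<Sum>l<p. f (n + (i * p + l)))"
  proof (rule sum.cong[OF refl])
    fix i
    show "(\<Sum>k = i * p..<i * p + p. f (n + k)) = (\<Sum>l<p. f (n + (i * p + l)))"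
      using sum.shift_bounds_nat_ivl[of "\<lambda>k. f (n + k)" 0 "i * p" p]
      by (simp add: lessThan_atLeast0 add_ac)
  qed
  also have "\<dots> = (\<Sum>i<n. if i = j then \<Sum>l<p. x $ l * \<beta> $ (n + j * p + l) else 0)"
    by (rule sum.cong[OF refl]) (auto simp: f_def add_ac)
  also have "\<dots> = (\<Sum>l<p. x $ l * \<beta> $ (n + j * p + l))"
    using j by simp
  finally show ?thesis by (simp add: n_def)
qed

text \<open>
  A model is represented by its parameter space together with the map \<open>(x, \<beta>) \<mapsto> \<pi>(x; \<beta>)\<close>.
  Here \<open>r\<close> is the ratio, \<open>F\<close> the cdf, and \<open>Z\<close> the design, with \<open>q\<close> columns.
  The definite descriptions below denote the intended vector because \<open>r\<close> is meant to be injective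
  on \<^term>\<open>prob_simplex J\<close> and \<open>\<sigma>\<close> to be a permutation of \<open>{..<J}\<close>; they are only used for
  \<open>x \<in> X\<close> and \<open>\<beta>\<close> in the parameter space.
\<close>

type_synonym model = "real vec set \<times> (real vec \<Rightarrow> real vec \<Rightarrow> real vec)"

definition param_space ::
  "nat \<Rightarrow> real vec set \<Rightarrow> (real vec \<Rightarrow> real vec) \<Rightarrow> (real \<Rightarrow> real) \<Rightarrow> nat \<Rightarrow>
    (real vec \<Rightarrow> real mat) \<Rightarrow> real vec set" where
  "param_space J X r F q Z =
    {\<beta> \<in> carrier_vec q. \<forall>x\<in>X.
      (\<forall>j<J - 1. (Z x *\<^sub>v \<beta>) $ j \<in> cdf_interval F) \<and>
      map_vec F (Z x *\<^sub>v \<beta>) \<in> r ` prob_simplex J}"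

definition model ::
  "nat \<Rightarrow> real vec set \<Rightarrow> (real vec \<Rightarrow> real vec) \<Rightarrow> (real \<Rightarrow> real) \<Rightarrow> nat \<Rightarrow>
    (real vec \<Rightarrow> real mat) \<Rightarrow> model" where
  "model J X r F q Z =
    (param_space J X r F q Z,
     \<lambda>x \<beta>. THE \<pi>. \<pi> \<in> prob_simplex J \<and> r \<pi> = map_vec F (Z x *\<^sub>v \<beta>))"

definition permute_probs :: "nat \<Rightarrow> (nat \<Rightarrow> nat) \<Rightarrow> real vec \<Rightarrow> real vec" where
  "permute_probs J \<sigma> \<pi> = Matrix.vec (J - 1) (\<lambda>j. cat_prob J \<pi> (\<sigma> j))"

definition permuted_model ::
  "nat \<Rightarrow> real vec set \<Rightarrow> (real vec \<Rightarrow> real vec) \<Rightarrow> (real \<Rightarrow> real) \<Rightarrow> nat \<Rightarrow>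
    (real vec \<Rightarrow> real mat) \<Rightarrow> (nat \<Rightarrow> nat) \<Rightarrow> model" where
  "permuted_model J X r F q Z \<sigma> =
    (param_space J X r F q Z,
     \<lambda>x \<beta>. THE \<pi>. \<pi> \<in> prob_simplex J \<and> r (permute_probs J \<sigma> \<pi>) = map_vec F (Z x *\<^sub>v \<beta>))"

definition equivalent_models :: "real vec set \<Rightarrow> model \<Rightarrow> model \<Rightarrow> bool" where
  "equivalent_models X m m' \<longleftrightarrow>
    (\<exists>h. bij_betw h (fst m) (fst m') \<and>
         (\<forall>x\<in>X. \<forall>\<beta>\<in>fst m. snd m x \<beta> = snd m' x (h \<beta>)))"

definition invariant_under ::
  "nat \<Rightarrow> real vec set \<Rightarrow> (real vec \<Rightarrow> real vec) \<Rightarrow> (real \<Rightarrow> real) \<Rightarrow> nat \<Rightarrow>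
    (real vec \<Rightarrow> real mat) \<Rightarrow> (nat \<Rightarrow> nat) \<Rightarrow> bool" where
  "invariant_under J X r F q Z \<sigma> \<longleftrightarrow>
    equivalent_models X (model J X r F q Z) (permuted_model J X r F q Z \<sigma>)"

end

theory Submission
  imports Defs "HOL-Combinatorics.Permutations"
begin

text \<open>
  Exchanging the last two categories leaves all but the last sequential ratio unchanged and
  replaces the last one, \<open>u\<close>, by \<open>1 - u\<close>. By symmetry of \<open>F\<close> this is the effect of negating the
  last linear predictor, which the complete design permits by negating the last intercept and the
  last slope block. As this parameter change is an involution, it is the required bijection.
\<close>

lemma cat_prob_sum:
  assumes "J \<ge> 1"
  shows "(\<Sum>j<J. cat_prob J \<pi> j) = 1"
proof -
  have "{..<J} = insert (J - 1) {..<J - 1}" using assms by auto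
  then show ?thesis by (simp add: cat_prob_def)
qed

text \<open>Puts all \<open>J\<close> categories on an equal footing, so that a permutation of them
  visibly preserves the simplex. From right to left, positivity of the last category bounds the sum
  of the stored entries by 1, and each of these positive entries is at most that sum.\<close>

lemma prob_simplex_iff:
  assumes "J \<ge> 1"
  shows "\<pi> \<in> prob_simplex J \<longleftrightarrow> \<pi> \<in> carrier_vec (J - 1) \<and> (\<forall>j<J. 0 < cat_prob J \<pi> j)"
proof
  assume "\<pi> \<in> prob_simplex J"
  then show "\<pi> \<in> carrier_vec (J - 1) \<and> (\<forall>j<J. 0 < cat_prob J \<pi> j)"
    by (auto simp: prob_simplex_def cat_prob_def)
next
  assume *: "\<pi> \<in> carrier_vec (J - 1) \<and> (\<forall>j<J. 0 < cat_prob J \<pi> j)"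
  have pos: "0 < \<pi> $ j" if "j < J - 1" for j
    using *[THEN conjunct2, rule_format, of j] that by (simp add: cat_prob_def)
  have sum: "(\<Sum>j<J - 1. \<pi> $ j) < 1"
    using *[THEN conjunct2, rule_format, of "J - 1"] assms by (simp add: cat_prob_def)
  have "\<pi> $ j < 1" if "j < J - 1" for j
  proof -
    have "\<pi> $ j \<le> (\<Sum>j<J - 1. \<pi> $ j)"
      using that by (intro member_le_sum) (auto intro: less_imp_le pos simp del: One_nat_def)
    with sum show ?thesis by simp
  qed
  with pos sum * show "\<pi> \<in> prob_simplex J" by (auto simp: prob_simplex_def)
qed

text \<open>Only the first \<open>J - 1\<close> entries are stored. The last category is 1 minus
  their sum, and since a permutation keeps the total at 1, this remainder is the probability of
  \<open>\<sigma> (J - 1)\<close>.\<close>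

lemma cat_prob_permute_probs:
  assumes "\<sigma> permutes {..<J}" and "j < J"
  shows "cat_prob J (permute_probs J \<sigma> \<pi>) j = cat_prob J \<pi> (\<sigma> j)"
proof (cases "j < J - 1")
  case True
  then show ?thesis by (simp add: cat_prob_def permute_probs_def)
next
  case False
  with assms(2) have j: "j = J - 1" "{..<J} = insert (J - 1) {..<J - 1}" by auto
  have "(\<Sum>i<J. cat_prob J \<pi> (\<sigma> i)) = 1"
    using sum.permute[OF assms(1), of "cat_prob J \<pi>"] cat_prob_sum[of J \<pi>] assms(2)
    by (simp add: o_def)
  then have "cat_prob J \<pi> (\<sigma> (J - 1)) = 1 - (\<Sum>i<J - 1. cat_prob J \<pi> (\<sigma> i))"
    unfolding j(2) by simp
  then show ?thesis
    by (simp add: j(1) cat_prob_def[of J "permute_probs J \<sigma> \<pi>"])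
       (simp add: permute_probs_def)
qed

lemma permute_probs_in_prob_simplex:
  assumes "\<sigma> permutes {..<J}" and "J \<ge> 1" and "\<pi> \<in> prob_simplex J"
  shows "permute_probs J \<sigma> \<pi> \<in> prob_simplex J"
proof -
  have "\<sigma> j < J" if "j < J" for j
    using permutes_in_image[OF assms(1), of j] that by simp
  with assms show ?thesis
    by (simp add: prob_simplex_iff cat_prob_permute_probs) (simp add: permute_probs_def)
qed

abbreviation swap_last :: "nat \<Rightarrow> nat \<Rightarrow> nat" where
  "swap_last J \<equiv> Transposition.transpose (J - 2) (J - 1)"

text \<open>The case \<open>j = 0\<close> gives a permutation of all categories; general
  \<open>j\<close> is for the tail sums in the denominators of the ratios.\<close>

lemma swap_last_permutes:
  assumes "J \<ge> 2" and "j \<le> J - 2"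
  shows "swap_last J permutes {j..<J}"
  by (rule permutes_swap_id) (use assms in auto)

definition complement_last :: "nat \<Rightarrow> real vec \<Rightarrow> real vec" where
  "complement_last J u = Matrix.vec (J - 1) (\<lambda>j. if j = J - 2 then 1 - u $ j else u $ j)"

lemma complement_last_involution:
  "u \<in> carrier_vec (J - 1) \<Longrightarrow> complement_last J (complement_last J u) = u"
  by (auto simp: complement_last_def intro!: eq_vecI)

lemma complement_last_index:
  "j < J - 1 \<Longrightarrow> complement_last J u $ j = (if j = J - 2 then 1 - u $ j else u $ j)"
  by (simp add: complement_last_def)

text \<open>Every denominator is a tail sum containing both swapped categories, so it does not
  change. Among the numerators only the one at \<open>J - 2\<close> changes, and there the old and
  the new one add up to the denominator.\<close>

lemma sequential_swap_last:
  assumes J: "J \<ge> 2" and \<pi>: "\<pi> \<in> prob_simplex J"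
  shows "sequential J (permute_probs J (swap_last J) \<pi>) =
    complement_last J (sequential J \<pi>)"
proof (rule eq_vecI)
  let ?P = "cat_prob J \<pi>" and ?Q = "cat_prob J (permute_probs J (swap_last J) \<pi>)"
  show "dim_vec (sequential J (permute_probs J (swap_last J) \<pi>)) =
      dim_vec (complement_last J (sequential J \<pi>))"
    by (simp add: sequential_def complement_last_def)
  fix j assume "j < dim_vec (complement_last J (sequential J \<pi>))"
  then have j: "j < J - 1" by (simp add: complement_last_def)
  have Q: "?Q k = ?P (swap_last J k)" if "k < J" for k
    using cat_prob_permute_probs[OF _ that] swap_last_permutes[of J 0] J
    by (simp add: lessThan_atLeast0)
  have "(\<Sum>k = j..<J. ?Q k) = (\<Sum>k = j..<J. ?P (swap_last J k))"
    by (rule sum.cong) (auto simp: Q simp del: One_nat_def)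
  also have "\<dots> = (\<Sum>k = j..<J. ?P k)"
    using sum.permute[OF swap_last_permutes[of J j], of ?P] J j by (simp add: o_def)
  finally have tail: "(\<Sum>k = j..<J. ?Q k) = (\<Sum>k = j..<J. ?P k)" .
  show "sequential J (permute_probs J (swap_last J) \<pi>) $ j =
      complement_last J (sequential J \<pi>) $ j"
  proof (cases "j = J - 2")
    case False
    then have "swap_last J j = j" using j by (simp add: transpose_apply_other)
    then show ?thesis
      using j False by (simp add: sequential_def complement_last_index tail Q[of j] del: One_nat_def)
  next
    case True
    \<comment> \<open>With a nonzero denominator,
      \<open>1 - a / (a + b) = b / (a + b)\<close>.\<close>
    have "0 < ?P (J - 2)" "0 < ?P (J - 1)"
      using \<pi> J by (auto simp: prob_simplex_iff)
    moreover have "{j..<J} = {J - 2, J - 1}" "J - 2 \<noteq> J - 1" using True J by auto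
    then have "(\<Sum>k = j..<J. ?P k) = ?P (J - 2) + ?P (J - 1)" by simp
    moreover have "?Q j = ?P (J - 1)" using Q[of j] j True by simp
    ultimately show ?thesis
      using j True tail
      by (simp add: sequential_def complement_last_index field_simps del: One_nat_def)
  qed
qed

text \<open>An involution is injective, so \<open>complement_last\<close> can be cancelled on
  vectors of length \<open>J - 1\<close>. This form matches the condition defining the permuted
  model with the one defining the original model.\<close>

lemma sequential_swap_last_iff:
  assumes J: "J \<ge> 2" and \<pi>: "\<pi> \<in> prob_simplex J" and u: "u \<in> carrier_vec (J - 1)"
  shows "sequential J (permute_probs J (swap_last J) \<pi>) = complement_last J u \<longleftrightarrow>
    sequential J \<pi> = u"
proof -
  have "sequential J \<pi> \<in> carrier_vec (J - 1)" by (simp add: sequential_def)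
  then show ?thesis
    using sequential_swap_last[OF J \<pi>] complement_last_involution u by metis
qed

text \<open>If \<open>u\<close> is the ratio of \<open>\<pi>\<close>, its complement is the ratio of
  \<open>\<pi>\<close> with the last two categories swapped.\<close>

lemma complement_last_in_range:
  assumes "J \<ge> 2" and "u \<in> sequential J ` prob_simplex J"
  shows "complement_last J u \<in> sequential J ` prob_simplex J"
proof -
  have "swap_last J permutes {..<J}"
    using swap_last_permutes[of J 0] assms(1) by (simp add: lessThan_atLeast0)
  with assms show ?thesis
    using permute_probs_in_prob_simplex sequential_swap_last
    by (auto simp: image_iff) (metis One_nat_def Suc_1 Suc_leD)
qed

text \<open>The last intercept has index \<open>J - 2\<close>; the last slope block starts at \<open>J - 1 + (J - 2) * p\<close>.\<close>

definition negate_last :: "nat \<Rightarrow> nat \<Rightarrow> real vec \<Rightarrow> real vec" where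
  "negate_last J p \<beta> = Matrix.vec (complete_ncols J p)
    (\<lambda>k. if k = J - 2 \<or> J - 1 + (J - 2) * p \<le> k then - \<beta> $ k else \<beta> $ k)"

lemma negate_last_involution:
  "\<beta> \<in> carrier_vec (complete_ncols J p) \<Longrightarrow> negate_last J p (negate_last J p \<beta>) = \<beta>"
  by (auto simp: negate_last_def intro!: eq_vecI)

text \<open>Each predictor of the complete design has its own intercept and slope block, so a sign
  change of the last ones reaches no other predictor.\<close>

lemma complete_design_negate_last:
  assumes "\<beta> \<in> carrier_vec (complete_ncols J p)" and j: "j < J - 1"
  shows "(complete_design J p x *\<^sub>v negate_last J p \<beta>) $ j =
    (if j = J - 2 then - (complete_design J p x *\<^sub>v \<beta>) $ j else (complete_design J p x *\<^sub>v \<beta>) $ j)"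
proof -
  define s :: real where "s = (if j = J - 2 then -1 else 1)"
  have q: "complete_ncols J p = J - 1 + (J - 1) * p" by (simp add: complete_ncols_def)
  have intercept: "negate_last J p \<beta> $ j = s * \<beta> $ j"
    using j by (auto simp: negate_last_def q s_def)
  have slope: "negate_last J p \<beta> $ (J - 1 + j * p + l) = s * \<beta> $ (J - 1 + j * p + l)"
    if l: "l < p" for l
  proof -
    \<comment> \<open>Slope block \<open>j\<close> ends before block \<open>i\<close> starts. Taking
      \<open>i = J - 1\<close> keeps the index within the columns; \<open>i = J - 2\<close> keeps it
      in front of the negated block.\<close>
    have less: "j * p + l < i * p" if "j < i" for i
    proof -
      have "j * p + l < Suc j * p" using l by simp
      also have "\<dots> \<le> i * p" using that by (intro mult_le_mono1) simp
      finally show ?thesis .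
    qed
    have "J - 1 + j * p + l < complete_ncols J p" using less[OF j] by (simp add: q)
    \<comment> \<open>Here \<open>j < J - 1\<close> forces \<open>J \<ge> 2\<close>; for smaller
      \<open>J\<close> truncated subtraction would make \<open>J - 1\<close> and
      \<open>J - 2\<close> both 0.\<close>
    moreover have "J - 1 + j * p + l \<noteq> J - 2" using j by simp
    moreover have "(J - 1 + (J - 2) * p \<le> J - 1 + j * p + l) \<longleftrightarrow> j = J - 2"
    proof (cases "j = J - 2")
      case False
      then have "j * p + l < (J - 2) * p" using j by (intro less) simp
      with False show ?thesis by simp
    qed simp
    ultimately show ?thesis by (simp add: negate_last_def s_def)
  qed
  have "negate_last J p \<beta> \<in> carrier_vec (complete_ncols J p)" by (simp add: negate_last_def)
  then have "(complete_design J p x *\<^sub>v negate_last J p \<beta>) $ j =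
      s * \<beta> $ j + (\<Sum>l<p. x $ l * negate_last J p \<beta> $ (J - 1 + j * p + l))"
    using j by (simp only: complete_design_mult_vec intercept)
  also have "(\<Sum>l<p. x $ l * negate_last J p \<beta> $ (J - 1 + j * p + l)) =
      s * (\<Sum>l<p. x $ l * \<beta> $ (J - 1 + j * p + l))"
    unfolding sum_distrib_left
    by (rule sum.cong[OF refl]) (simp only: slope lessThan_iff mult.left_commute)
  finally have "(complete_design J p x *\<^sub>v negate_last J p \<beta>) $ j =
      s * (complete_design J p x *\<^sub>v \<beta>) $ j"
    unfolding complete_design_mult_vec[OF assms] by (simp only: distrib_left)
  then show ?thesis by (simp add: s_def)
qed

lemma map_vec_negate_last:
  assumes "\<And>w. F w = 1 - F (- w)" and "\<beta> \<in> carrier_vec (complete_ncols J p)"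
  shows "map_vec F (complete_design J p x *\<^sub>v negate_last J p \<beta>) =
    complement_last J (map_vec F (complete_design J p x *\<^sub>v \<beta>))"
proof (rule eq_vecI)
  have dim: "dim_vec (complete_design J p x *\<^sub>v \<gamma>) = J - 1" for \<gamma>
    by (simp add: complete_design_def)
  show "dim_vec (map_vec F (complete_design J p x *\<^sub>v negate_last J p \<beta>)) =
      dim_vec (complement_last J (map_vec F (complete_design J p x *\<^sub>v \<beta>)))"
    by (simp add: complement_last_def complete_design_def)
  fix j assume "j < dim_vec (complement_last J (map_vec F (complete_design J p x *\<^sub>v \<beta>)))"
  then have j: "j < J - 1" by (simp add: complement_last_def)
  have F: "F (- w) = 1 - F w" for w using assms(1)[of w] by simp
  have idx: "map_vec F (complete_design J p x *\<^sub>v \<gamma>) $ j = F ((complete_design J p x *\<^sub>v \<gamma>) $ j)"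
    for \<gamma> using j dim by (metis index_map_vec(1))
  show "map_vec F (complete_design J p x *\<^sub>v negate_last J p \<beta>) $ j =
      complement_last J (map_vec F (complete_design J p x *\<^sub>v \<beta>)) $ j"
    unfolding complement_last_index[OF j] idx complete_design_negate_last[OF assms(2) j]
    by (simp only: F split: if_split) simp
qed

text \<open>Both constraints survive: by symmetry of \<open>F\<close> the interval
  \<open>cdf_interval F\<close> is closed under negation, and the range of the ratio is closed under
  \<open>complement_last\<close>.\<close>

lemma negate_last_in_param_space:
  assumes J: "J \<ge> 2" and F: "\<And>w. F w = 1 - F (- w)"
    and \<beta>: "\<beta> \<in> param_space J X (sequential J) F (complete_ncols J p) (complete_design J p)"
  shows "negate_last J p \<beta> \<in>
    param_space J X (sequential J) F (complete_ncols J p) (complete_design J p)"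
proof -
  have carrier: "\<beta> \<in> carrier_vec (complete_ncols J p)" using \<beta> by (simp add: param_space_def)
  have "- w \<in> cdf_interval F" if "w \<in> cdf_interval F" for w
    using that F[of w] by (auto simp: cdf_interval_def)
  then show ?thesis
    using \<beta> complement_last_in_range[OF J]
    by (auto simp: param_space_def complete_design_negate_last[OF carrier]
        map_vec_negate_last[of F, OF F carrier]) (auto simp: negate_last_def)
qed

theorem corollary10:
  fixes J p :: nat and X :: "real vec set" and F :: "real \<Rightarrow> real"
  assumes "J \<ge> 3" and "p \<ge> 1"
    and "X \<subseteq> carrier_vec p" and "X \<noteq> {}"
    and "F \<in> symmetric_cdfs"
  shows "invariant_under J X (sequential J) F (complete_ncols J p) (complete_design J p)
    (Transposition.transpose (J - 2) (J - 1))"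
proof -
  let ?B = "param_space J X (sequential J) F (complete_ncols J p) (complete_design J p)"
  have J: "J \<ge> 2" using assms(1) by simp
  have F: "F w = 1 - F (- w)" for w using assms(5) unfolding symmetric_cdfs_def by blast
  have carrier: "\<beta> \<in> carrier_vec (complete_ncols J p)" if "\<beta> \<in> ?B" for \<beta>
    using that by (simp add: param_space_def)
  have image: "negate_last J p \<beta> \<in> ?B" if "\<beta> \<in> ?B" for \<beta>
    using J F that by (rule negate_last_in_param_space)
  have "bij_betw (negate_last J p) ?B ?B"
    by (rule bij_betw_byWitness[where f' = "negate_last J p"])
       (auto simp: image negate_last_involution[OF carrier])
  \<comment> \<open>Both models pick \<open>\<pi>\<close> by a definite description. The two
    predicates agree for every \<open>\<pi>\<close>, hence so do the described vectors.\<close>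
  moreover have "(\<pi> \<in> prob_simplex J \<and> sequential J \<pi> = map_vec F (complete_design J p x *\<^sub>v \<beta>)) =
      (\<pi> \<in> prob_simplex J \<and> sequential J (permute_probs J (swap_last J) \<pi>) =
        map_vec F (complete_design J p x *\<^sub>v negate_last J p \<beta>))"
    if "\<beta> \<in> ?B" for \<beta> \<pi> x
  proof -
    have "map_vec F (complete_design J p x *\<^sub>v \<beta>) \<in> carrier_vec (J - 1)"
      by (rule carrier_vecI) (simp add: complete_design_def)
    then show ?thesis
      unfolding map_vec_negate_last[of F, OF F carrier[OF that]]
      using sequential_swap_last_iff[OF J] by blast
  qed
  ultimately show ?thesis
    unfolding invariant_under_def equivalent_models_def model_def permuted_model_def
    by (intro exI[of _ "negate_last J p"]) simp
qed

end
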